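(* Let $p,q\geq 1$ and $r>q+1$ be integers. Then \[ \zeta_{H^{(p,q+1)}}(r)=\frac{1}{q!}\sum_{m=0}^{q}\sum_{k=0}^{m}(-1)^{k}\genfrac{[}{]}{0pt}{}{q+1}{m+1}\binom{m}{k}\,\zeta_{H^{(p-k)}}(r+k-m). \]
   Context: For $p\in\mathbb{Z}$ and $n\geq1$, $H_n^{(p)}=\sum_{j=1}^{n}j^{-p}$. The generalized hyperharmonic numbers are defined by $H_n^{(p,0)}=1/n^{p}$ and $H_n^{(p,r)}=\sum_{k=1}^{n}H_k^{(p,r-1)}$ for $r\geq1$. Euler sums: $\zeta_{H^{(p)}}(s)=\sum_{n=1}^{\infty}H_n^{(p)}/n^{s}$ and $\zeta_{H^{(p,q)}}(s)=\sum_{n=1}^{\infty}H_n^{(p,q)}/n^{s}$. $\genfrac{[}{]}{0pt}{}{n}{k}$ denotes the (unsigned) Stirling number of the first kind, defined by $x(x+1)\cdots(x+n-1)=\sum_{k=0}^{n}\genfrac{[}{]}{0pt}{}{n}{k}x^{k}$. *)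

theory Defs
  imports "HOL-Analysis.Analysis" "HOL-Combinatorics.Stirling"
begin

definition gen_harmonic :: "int \<Rightarrow> nat \<Rightarrow> real" where
  "gen_harmonic p n = (\<Sum>j=1..n. real j powi (- p))"

text \<open>Only the values at \<open>n \<ge> 1\<close> are meaningful; the second equation never refers to index 0.\<close>

fun hyperharmonic :: "int \<Rightarrow> nat \<Rightarrow> nat \<Rightarrow> real" where
  "hyperharmonic p 0 n = 1 / real n powi p"
| "hyperharmonic p (Suc r) n = (\<Sum>k=1..n. hyperharmonic p r k)"

text \<open>The Dirichlet series over \<open>n \<ge> 1\<close> is indexed from 0 by shifting: the term with index \<open>n\<close>
  here is the term with index \<open>n + 1\<close> of the series.\<close>

definition dirichlet_term :: "(nat \<Rightarrow> real) \<Rightarrow> int \<Rightarrow> nat \<Rightarrow> real" where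
  "dirichlet_term a s n = a (Suc n) / real (Suc n) powi s"

definition zeta_harmonic :: "int \<Rightarrow> int \<Rightarrow> real" where
  "zeta_harmonic p s = (\<Sum>n. dirichlet_term (gen_harmonic p) s n)"

definition zeta_hyperharmonic :: "int \<Rightarrow> nat \<Rightarrow> int \<Rightarrow> real" where
  "zeta_hyperharmonic p q s = (\<Sum>n. dirichlet_term (hyperharmonic p q) s n)"

end

theory Submission
  imports Defs
begin

text \<open>Unfolding the iterated partial sums, \<open>j powi (- p)\<close> contributes to \<open>hyperharmonic p (q + 1) n\<close>
  with multiplicity \<open>(n - j + q) choose q\<close>. This is a polynomial in \<open>n - j\<close> whose coefficients are
  Stirling numbers over \<open>fact q\<close>; expanding the powers \<open>(n - j) ^ m\<close> binomially separates \<open>n\<close>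
  from \<open>j\<close> and leaves a finite combination of generalized harmonic numbers.\<close>

text \<open>Induction on \<open>q\<close>, with an inner induction on \<open>n\<close>: raising
  \<open>n\<close> by one adds a single hyperharmonic number of the previous order, and Pascal's
  rule merges the two binomial weights. The new index \<open>j = Suc n\<close> enters with weight
  1.\<close>

lemma hyperharmonic_Suc_eq_sum_binomial:
  "hyperharmonic p (Suc q) n = (\<Sum>j=1..n. real ((n - j + q) choose q) * real j powi (- p))"
proof (induction q arbitrary: n)
  case 0
  show ?case
    by (simp add: power_int_minus field_simps)
next
  case (Suc q)
  note outer = this
  show ?case
  proof (induction n)
    case (Suc n)
    have "hyperharmonic p (Suc (Suc q)) (Suc n)
      = hyperharmonic p (Suc (Suc q)) n + hyperharmonic p (Suc q) (Suc n)"
      by simp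
    also have "\<dots> = (\<Sum>j=1..n. real ((n - j + Suc q) choose Suc q) * real j powi (- p))
        + (\<Sum>j=1..Suc n. real ((Suc n - j + q) choose q) * real j powi (- p))"
      by (simp only: Suc.IH outer)
    also have "\<dots> = (\<Sum>j=1..n. (real ((n - j + Suc q) choose Suc q)
          + real ((Suc n - j + q) choose q)) * real j powi (- p)) + real (Suc n) powi (- p)"
      by (simp add: sum.distrib distrib_right)
    also have "(\<Sum>j=1..n. (real ((n - j + Suc q) choose Suc q)
          + real ((Suc n - j + q) choose q)) * real j powi (- p))
        = (\<Sum>j=1..n. real ((Suc n - j + Suc q) choose Suc q) * real j powi (- p))"
      \<comment> \<open>Since \<open>j \<le> n\<close>, \<open>Suc n - j\<close> is
        \<open>Suc (n - j)\<close>, so the two binomials are neighbours in Pascal's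
        triangle.\<close>
      by (intro sum.cong) (auto simp: Suc_diff_le)
    finally show ?case
      by simp
  qed simp
qed

text \<open>The defining identity of the Stirling numbers for \<open>pochhammer x (Suc q)\<close>,
  with a factor \<open>x\<close> cancelled. At \<open>x = 0\<close> cancellation fails, but both
  sides equal \<open>fact q\<close>.\<close>

lemma pochhammer_plus_1_eq_sum_stirling:
  fixes x :: "'a::field_char_0"
  shows "pochhammer (x + 1) q = (\<Sum>m\<le>q. of_nat (stirling (Suc q) (Suc m)) * x ^ m)"
proof (cases "x = 0")
  case True
  have "(\<Sum>m\<le>q. of_nat (stirling (Suc q) (Suc m)) * x ^ m) = of_nat (stirling (Suc q) 1)"
    using True by (subst sum.remove[of _ 0]) (auto simp: sum.neutral)
  then show ?thesis
    using True by (simp add: stirling_Suc_n_1 pochhammer_fact[symmetric] del: stirling.simps(4))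
next
  case False
  have "x * pochhammer (x + 1) q = pochhammer x (Suc q)"
    by (simp add: pochhammer_rec)
  also have "\<dots> = (\<Sum>k\<le>Suc q. of_nat (stirling (Suc q) k) * x ^ k)"
    by (rule stirling_pochhammer[symmetric])
  \<comment> \<open>The term \<open>k = 0\<close> vanishes because
    \<open>stirling (Suc q) 0 = 0\<close>.\<close>
  also have "\<dots> = x * (\<Sum>m\<le>q. of_nat (stirling (Suc q) (Suc m)) * x ^ m)"
    by (subst sum.atMost_Suc_shift) (simp add: sum_distrib_left mult_ac del: stirling.simps(4))
  finally show ?thesis
    using False by simp
qed

lemma binomial_eq_pochhammer:
  "real ((x + q) choose q) = pochhammer (real x + 1) q / fact q"
  by (simp add: binomial_gbinomial gbinomial_pochhammer')

lemma binomial_eq_sum_stirling: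
  assumes "j \<le> n"
  shows "real ((n - j + q) choose q) = 1 / fact q * (\<Sum>m=0..q. \<Sum>k=0..m.
    (-1) ^ k * real (stirling (q + 1) (m + 1)) * real (m choose k) * (real j ^ k * real n ^ (m - k)))"
proof -
  have "(real n - real j) ^ m
      = (\<Sum>k=0..m. (-1) ^ k * real (m choose k) * (real j ^ k * real n ^ (m - k)))" for m
    using binomial_ring[of "- real j" "real n" m]
    by (simp add: atLeast0AtMost power_minus[of "real j"] mult_ac)
  then show ?thesis
    unfolding binomial_eq_pochhammer pochhammer_plus_1_eq_sum_stirling of_nat_diff[OF assms]
    by (simp add: atLeast0AtMost sum_distrib_left sum_divide_distrib mult_ac del: stirling.simps)
qed

text \<open>The claimed identity holds already term by term, so only finite sums are rearranged and
  no convergence is involved.\<close>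

lemma dirichlet_term_hyperharmonic:
  "dirichlet_term (hyperharmonic p (q + 1)) r n = 1 / fact q * (\<Sum>m=0..q. \<Sum>k=0..m.
    (-1) ^ k * real (stirling (q + 1) (m + 1)) * real (m choose k) *
      dirichlet_term (gen_harmonic (p - int k)) (r + int k - int m) n)"
proof -
  define N where "N = Suc n"
  have N: "real N \<noteq> 0" by (simp add: N_def)
  have "hyperharmonic p (q + 1) N = (\<Sum>j=1..N. (1 / fact q * (\<Sum>m=0..q. \<Sum>k=0..m.
      (-1) ^ k * real (stirling (q + 1) (m + 1)) * real (m choose k) *
        (real j ^ k * real N ^ (m - k)))) * real j powi (- p))"
    unfolding Suc_eq_plus1[symmetric] hyperharmonic_Suc_eq_sum_binomial
    by (intro sum.cong refl arg_cong2[of _ _ _ _ "(*)"])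
      (simp only: binomial_eq_sum_stirling Suc_eq_plus1 atLeastAtMost_iff)
  also have "\<dots> = 1 / fact q * (\<Sum>m=0..q. \<Sum>k=0..m. \<Sum>j=1..N.
      (-1) ^ k * real (stirling (q + 1) (m + 1)) * real (m choose k) *
        (real j ^ k * real N ^ (m - k)) * real j powi (- p))"
    unfolding sum_distrib_left sum_distrib_right
    by (rule trans[OF sum.swap], rule sum.cong[OF refl], rule trans[OF sum.swap])
      (simp only: mult.assoc)
  also have "(\<Sum>m=0..q. \<Sum>k=0..m. \<Sum>j=1..N.
      (-1) ^ k * real (stirling (q + 1) (m + 1)) * real (m choose k) *
        (real j ^ k * real N ^ (m - k)) * real j powi (- p))
    = (\<Sum>m=0..q. \<Sum>k=0..m. (-1) ^ k * real (stirling (q + 1) (m + 1)) * real (m choose k) *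
        (real N ^ (m - k) * gen_harmonic (p - int k) N))"
  proof (intro sum.cong refl)
    fix m k :: nat
    have "real j ^ k * real j powi (- p) = real j powi (- (p - int k))" if "j \<in> {1..N}" for j
      using that power_int_add[of "real j" "- p" "int k"] by (simp add: mult.commute)
    then show "(\<Sum>j=1..N. (-1) ^ k * real (stirling (q + 1) (m + 1)) * real (m choose k) *
        (real j ^ k * real N ^ (m - k)) * real j powi (- p))
      = (-1) ^ k * real (stirling (q + 1) (m + 1)) * real (m choose k) *
        (real N ^ (m - k) * gen_harmonic (p - int k) N)"
      unfolding gen_harmonic_def sum_distrib_left
      by (intro sum.cong refl) (simp add: mult_ac del: stirling.simps)
  qed
  finally have H: "hyperharmonic p (q + 1) N = 1 / fact q * (\<Sum>m=0..q. \<Sum>k=0..m.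
      (-1) ^ k * real (stirling (q + 1) (m + 1)) * real (m choose k) *
        (real N ^ (m - k) * gen_harmonic (p - int k) N))" .
  \<comment> \<open>The powers of \<open>n\<close> left over from the binomial expansion shift the
    exponent \<open>r\<close> of the Dirichlet series.\<close>
  have D: "real N ^ (m - k) * h / real N powi r = h / real N powi (r + int k - int m)"
    if "k \<le> m" for m k h
  proof -
    have "real N powi r = real N powi (r + int k - int m) * real N powi int (m - k)"
      using N that by (subst power_int_add[symmetric]) (auto simp: of_nat_diff)
    then show ?thesis using N by simp
  qed
  show ?thesis
    unfolding dirichlet_term_def N_def[symmetric] H times_divide_eq_right[symmetric]
      sum_divide_distrib
    by (intro arg_cong2[of _ _ _ _ "(*)"] sum.cong refl)
      (auto simp: D simp del: stirling.simps)
qed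

text \<open>A crude bound replacing logarithmic growth; any exponent below 1 is enough for the
  comparison series to converge.\<close>

lemma harmonic_le_sqrt: "(\<Sum>j=1..n. 1 / real j) \<le> 2 * sqrt (real n)"
proof (induction n)
  case (Suc n)
  let ?a = "sqrt (real n)" and ?b = "sqrt (real (Suc n))"
  have ab: "?a \<le> ?b"
    by simp
  have "?b * 1 \<le> ?b * ?b"
    by (intro mult_left_mono) simp_all
  then have b: "?b \<le> real (Suc n)"
    by simp
  have "1 = (?b - ?a) * (?b + ?a)"
    by (simp add: algebra_simps)
  \<comment> \<open>Both square roots are at most \<open>Suc n\<close>, hence so is half their
    sum.\<close>
  also have "\<dots> \<le> (?b - ?a) * (2 * real (Suc n))"
    using add_mono[OF b order.trans[OF ab b]] ab by (intro mult_left_mono) simp_all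
  finally have "1 / real (Suc n) \<le> 2 * (?b - ?a)"
    by (simp add: field_simps)
  then show ?case using Suc.IH by simp
qed simp

text \<open>Since \<open>j ^ k \<le> n ^ k\<close>, the numerator is at most \<open>n ^ k\<close> times the classical harmonic number,
  so the term is \<open>O(n powr (-3/2))\<close> for every \<open>k\<close> at once.\<close>

lemma summable_dirichlet_term_gen_harmonic:
  fixes p s :: int
  assumes "p \<ge> 1" and "s \<ge> int k + 2"
  shows "summable (dirichlet_term (gen_harmonic (p - int k)) s)"
proof (rule summable_comparison_test')
  have "summable (\<lambda>n. real n powr (-3/2))"
    by (subst summable_real_powr_iff) simp
  then show "summable (\<lambda>n. 2 * real (Suc n) powr (-3/2))"
    by (intro summable_mult) (subst summable_Suc_iff)
next
  fix n :: nat
  define N where "N = Suc n"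
  have N: "real N \<ge> 1" by (simp add: N_def)
  have "gen_harmonic (p - int k) N \<le> (\<Sum>j=1..N. real N ^ k * (1 / real j))"
    unfolding gen_harmonic_def
  proof (rule sum_mono)
    fix j assume j: "j \<in> {1..N}"
    \<comment> \<open>From \<open>p \<ge> 1\<close> the exponent \<open>k - p\<close> is at most
      \<open>k - 1\<close>.\<close>
    then have "real j powi (- (p - int k)) \<le> real j powi (int k + - 1)"
      using assms by (intro power_int_increasing) auto
    also have "\<dots> = real j ^ k * (1 / real j)"
      using j by (subst power_int_add) (auto simp: power_int_minus field_simps)
    also have "\<dots> \<le> real N ^ k * (1 / real j)"
      using j by (intro mult_right_mono power_mono) auto
    finally show "real j powi (- (p - int k)) \<le> real N ^ k * (1 / real j)" .
  qed
  also have "\<dots> \<le> real N ^ k * (2 * sqrt (real N))"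
    unfolding sum_distrib_left[symmetric] by (intro mult_left_mono harmonic_le_sqrt) simp
  finally have le: "gen_harmonic (p - int k) N \<le> real N ^ k * (2 * sqrt (real N))" .
  have ge: "gen_harmonic (p - int k) N \<ge> 0"
    unfolding gen_harmonic_def by (intro sum_nonneg) simp
  \<comment> \<open>Lowering \<open>s\<close> to \<open>k + 2\<close> lets \<open>N ^ k\<close>
    cancel.\<close>
  have "gen_harmonic (p - int k) N / real N powi s
      \<le> real N ^ k * (2 * sqrt (real N)) / real N powi (int k + 2)"
    using le ge N assms by (intro frac_le power_int_increasing) auto
  also have "\<dots> = 2 * (sqrt (real N) / real N ^ 2)"
    using N by (subst power_int_add) (auto simp: field_simps)
  also have "sqrt (real N) / real N ^ 2 = real N powr (1/2) / real N powr 2"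
    using N by (simp add: powr_half_sqrt)
  also have "\<dots> = real N powr (-3/2)"
    by (subst powr_diff[symmetric]) simp
  finally show "norm (dirichlet_term (gen_harmonic (p - int k)) s n) \<le> 2 * real (Suc n) powr (-3/2)"
    using ge N by (simp add: dirichlet_term_def N_def)
qed

theorem theorem2:
  fixes p r :: int and q :: nat
  assumes "p \<ge> 1" and "q \<ge> 1" and "r > int q + 1"
  shows "summable (dirichlet_term (hyperharmonic p (q + 1)) r) \<and>
    (\<forall>m\<le>q. \<forall>k\<le>m. summable (dirichlet_term (gen_harmonic (p - int k)) (r + int k - int m))) \<and>
    zeta_hyperharmonic p (q + 1) r =
      1 / fact q * (\<Sum>m=0..q. \<Sum>k=0..m. (-1) ^ k * real (stirling (q + 1) (m + 1)) *
        real (m choose k) * zeta_harmonic (p - int k) (r + int k - int m))"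
proof -
  have summ: "summable (dirichlet_term (gen_harmonic (p - int k)) (r + int k - int m))"
    if "m \<le> q" "k \<le> m" for m k
    \<comment> \<open>As \<open>r \<ge> q + 2\<close> and \<open>m \<le> q\<close>, the exponent
      \<open>r + k - m\<close> is at least \<open>k + 2\<close>.\<close>
    using assms that by (intro summable_dirichlet_term_gen_harmonic) auto
  have "(\<lambda>n. 1 / fact q * (\<Sum>m=0..q. \<Sum>k=0..m. (-1) ^ k * real (stirling (q + 1) (m + 1)) *
        real (m choose k) * dirichlet_term (gen_harmonic (p - int k)) (r + int k - int m) n))
    sums (1 / fact q * (\<Sum>m=0..q. \<Sum>k=0..m. (-1) ^ k * real (stirling (q + 1) (m + 1)) *
        real (m choose k) * zeta_harmonic (p - int k) (r + int k - int m)))"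
    unfolding zeta_harmonic_def
    by (intro sums_mult sums_sum summable_sums summ) auto
  then have "dirichlet_term (hyperharmonic p (q + 1)) r
    sums (1 / fact q * (\<Sum>m=0..q. \<Sum>k=0..m. (-1) ^ k * real (stirling (q + 1) (m + 1)) *
        real (m choose k) * zeta_harmonic (p - int k) (r + int k - int m)))"
    unfolding dirichlet_term_hyperharmonic[symmetric] .
  then show ?thesis
    using summ by (auto simp: sums_iff zeta_hyperharmonic_def simp del: stirling.simps)
qed

end
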